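(* Let $G=(\mathcal{N},\mathcal{A})$, $\mathcal{N}=\{1,\dots,n\}$, be the network with origin $1$, destination $n$, and data $\tau_{ij}$, $e_{ij}$, $g_i$, $B$, $E_1$ described in the context. Let $\{x_{ij},r_i\}$, $i,j\in\mathcal{N}$, be an optimal solution of the single-vehicle routing and recharging problem P1 stated in the context, with associated residual energies $E_1,\dots,E_n$, where the arcs $(i,j)$ with $x_{ij}=1$ form a directed path from $1$ to $n$ without repeated nodes. Then $$\sum_{i=1}^{n}\sum_{j=1}^{n}(r_i x_{ij}-e_{ij}x_{ij})\,g_i=\sum_{i=1}^{n}\sum_{j=1}^{n}(E_j-E_i)\,g_i\,x_{ij}=\sum_{i=1}^{n}\sum_{j=1}^{n}E_j\,(g_i-g_j)\,x_{ij}-E_1g_1 .$$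
   Context: $G=(\mathcal{N},\mathcal{A})$ is a directed graph with $\mathcal{N}=\{1,\dots,n\}$; node $1$ is the origin and node $n$ the destination. For $i\in\mathcal{N}$ put $I(i)=\{j\in\mathcal{N}:(j,i)\in\mathcal{A}\}$ and $O(i)=\{j\in\mathcal{N}:(i,j)\in\mathcal{A}\}$, and assume $I(1)=\varnothing$. Each arc $(i,j)\in\mathcal{A}$ has a traveling time $\tau_{ij}>0$ and an energy consumption $e_{ij}\in\mathbb{R}$ (possibly negative) with $e_{ij}<B$, where $B>0$ is the battery capacity of the vehicle. Node $i$ has a charging time per unit of energy $g_i\ge 0$, with $g_n=0$. The initial energy $E_1\in[0,B]$ is given. Pairs $(i,j)\notin\mathcal{A}$ are never selected: $x_{ij}=0$, and the corresponding terms in all sums are $0$. There is no recharging at $n$ (put $r_n=0$). Problem P1: minimize over $x_{ij}$, $r_i$ $$\sum_{i=1}^{n}\sum_{j=1}^{n}\tau_{ij}x_{ij}+\sum_{i=1}^{n}\sum_{j=1}^{n}r_i g_i x_{ij}$$ subject to $\sum_{j\in O(i)}x_{ij}-\sum_{j\in I(i)}x_{ji}=b_i$ for each $i\in\mathcal{N}$, where $b_1=1$, $b_n=-1$ and $b_i=0$ for $i\ne 1,n$; $E_j=\sum_{i\in I(j)}(E_i+r_i-e_{ij})x_{ij}$ for $j=2,\dots,n$; $0\le E_i\le B$ for each $i\in\mathcal{N}$; $x_{ij}\in\{0,1\}$ and $r_i\ge 0$. Here $x_{ij}=1$ means that arc $(i,j)$ is selected, $r_i$ is the amount of energy recharged at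 node $i$, and $E_i$ is the residual battery energy at node $i$. The selected arcs represent a single vehicle path from $1$ to $n$ that uses at most one outgoing arc per node; in particular $E_j=E_i+r_i-e_{ij}$ if $x_{ij}=1$, and $E_j=0$ if $j\neq 1$ is not on the path. *)

theory Defs
  imports Complex_Main
begin

(* All data are total functions; their values outside the node set {1..n}, and
   those of \<tau> and e outside A, are unconstrained and play no role. *)
locale ev_network =
  fixes n :: nat
    and A :: "(nat \<times> nat) set"
    and \<tau> :: "nat \<Rightarrow> nat \<Rightarrow> real"
    and e :: "nat \<Rightarrow> nat \<Rightarrow> real"
    and g :: "nat \<Rightarrow> real"
    and B :: real
    and E_init :: real
  assumes two_nodes: "2 \<le> n"
    and arcs_subset: "A \<subseteq> {1..n} \<times> {1..n}"
    and no_arc_into_origin: "{j \<in> {1..n}. (j, 1) \<in> A} = {}"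
    and time_pos: "\<And>i j. (i, j) \<in> A \<Longrightarrow> \<tau> i j > 0"
    and energy_less: "\<And>i j. (i, j) \<in> A \<Longrightarrow> e i j < B"
    and capacity_pos: "B > 0"
    and charging_nonneg: "\<And>i. i \<in> {1..n} \<Longrightarrow> g i \<ge> 0"
    and charging_destination: "g n = 0"
    and initial_energy: "E_init \<in> {0..B}"
begin

definition in_nodes :: "nat \<Rightarrow> nat set"
  where "in_nodes i = {j \<in> {1..n}. (j, i) \<in> A}"

definition out_nodes :: "nat \<Rightarrow> nat set"
  where "out_nodes i = {j \<in> {1..n}. (i, j) \<in> A}"

definition balance :: "nat \<Rightarrow> real"
  where "balance i = (if i = 1 then 1 else if i = n then -1 else 0)"

definition cost :: "(nat \<Rightarrow> nat \<Rightarrow> real) \<Rightarrow> (nat \<Rightarrow> real) \<Rightarrow> real"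
  where "cost x r =
    (\<Sum>i=1..n. \<Sum>j=1..n. \<tau> i j * x i j) + (\<Sum>i=1..n. \<Sum>j=1..n. r i * g i * x i j)"

definition feasible ::
    "(nat \<Rightarrow> nat \<Rightarrow> real) \<Rightarrow> (nat \<Rightarrow> real) \<Rightarrow> (nat \<Rightarrow> real) \<Rightarrow> bool"
  where "feasible x r E \<longleftrightarrow>
    (\<forall>i\<in>{1..n}. (\<Sum>j\<in>out_nodes i. x i j) - (\<Sum>j\<in>in_nodes i. x j i) = balance i) \<and>
    E 1 = E_init \<and>
    (\<forall>j\<in>{2..n}. E j = (\<Sum>i\<in>in_nodes j. (E i + r i - e i j) * x i j)) \<and>
    (\<forall>i\<in>{1..n}. 0 \<le> E i \<and> E i \<le> B) \<and>
    (\<forall>i\<in>{1..n}. \<forall>j\<in>{1..n}. x i j \<in> {0, 1}) \<and>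
    (\<forall>i\<in>{1..n}. \<forall>j\<in>{1..n}. (i, j) \<notin> A \<longrightarrow> x i j = 0) \<and>
    (\<forall>i\<in>{1..n}. r i \<ge> 0) \<and>
    r n = 0"

definition optimal ::
    "(nat \<Rightarrow> nat \<Rightarrow> real) \<Rightarrow> (nat \<Rightarrow> real) \<Rightarrow> (nat \<Rightarrow> real) \<Rightarrow> bool"
  where "optimal x r E \<longleftrightarrow>
    feasible x r E \<and> (\<forall>x' r' E'. feasible x' r' E' \<longrightarrow> cost x r \<le> cost x' r')"

(* zip p (tl p) lists the pairs of consecutive nodes of p, so the selected arcs are
   exactly the arcs of the path p; no arc off the path is selected. *)
definition selects_simple_path :: "(nat \<Rightarrow> nat \<Rightarrow> real) \<Rightarrow> bool"
  where "selects_simple_path x \<longleftrightarrow>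
    (\<exists>p. p \<noteq> [] \<and> hd p = 1 \<and> last p = n \<and> distinct p \<and>
      {(i, j). i \<in> {1..n} \<and> j \<in> {1..n} \<and> x i j = 1} = set (zip p (tl p)))"

end

end

theory Submission
  imports Defs
begin

text \<open>On a simple path every node has at most one selected incoming arc, so the energy equation
  collapses to \<open>E j = E i + r i - e i j\<close> on each selected arc; this gives the first equality termwise.
  For the second, the two sides differ by the total increment of the potential \<open>\<lambda>i. E i * g i\<close> along
  the selected arcs, which flow conservation evaluates as
  \<open>E n * g n - E 1 * g 1 = - (E 1 * g 1)\<close>.\<close>

text \<open>Since \<open>tl p\<close> is distinct, \<open>k\<close> occupies a single position in
  it, and the entry of \<open>p\<close> at that same index is the predecessor.\<close>

lemma distinct_zip_tl_pred_unique:
  assumes "distinct p" "(i, k) \<in> set (zip p (tl p))" "(j, k) \<in> set (zip p (tl p))"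
  shows "i = j"
proof -
  from assms(2) obtain a where a: "a < length (tl p)" "p ! a = i" "tl p ! a = k"
    by (auto simp: in_set_zip)
  from assms(3) obtain b where b: "b < length (tl p)" "p ! b = j" "tl p ! b = k"
    by (auto simp: in_set_zip)
  from a b have "a = b"
    using nth_eq_iff_index_eq[OF distinct_tl[OF assms(1)], of a b] by simp
  with a b show ?thesis by simp
qed

context ev_network
begin

lemma feasible_arcD:
  assumes "feasible x r E" "i \<in> {1..n}" "j \<in> {1..n}" "x i j \<noteq> 0"
  shows "(i, j) \<in> A" "x i j = 1"
  using assms unfolding feasible_def by blast+

lemma sum_out_nodes:
  assumes "feasible x r E" "i \<in> {1..n}"
  shows "(\<Sum>j\<in>out_nodes i. x i j) = (\<Sum>j=1..n. x i j)"
  using assms by (intro sum.mono_neutral_left) (auto simp: out_nodes_def feasible_def)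

lemma sum_in_nodes:
  assumes "feasible x r E" "i \<in> {1..n}"
  shows "(\<Sum>j\<in>in_nodes i. x j i) = (\<Sum>j=1..n. x j i)"
  using assms by (intro sum.mono_neutral_left) (auto simp: in_nodes_def feasible_def)

text \<open>Summation by parts: collecting the terms by node, \<open>f i\<close> is multiplied by
  inflow minus outflow at \<open>i\<close>, which flow conservation makes nonzero only at the two
  endpoints.\<close>

lemma sum_potential_difference:
  assumes "feasible x r E"
  shows "(\<Sum>i=1..n. \<Sum>j=1..n. (f j - f i) * x i j) = f n - f 1"
proof -
  have "(\<Sum>i=1..n. \<Sum>j=1..n. (f j - f i) * x i j)
      = (\<Sum>i=1..n. \<Sum>j=1..n. f j * x i j) - (\<Sum>i=1..n. \<Sum>j=1..n. f i * x i j)"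
    by (simp add: left_diff_distrib sum_subtractf)
  also have "(\<Sum>i=1..n. \<Sum>j=1..n. f j * x i j) = (\<Sum>j=1..n. \<Sum>i=1..n. f j * x i j)"
    by (rule sum.swap)
  also have "\<dots> - (\<Sum>i=1..n. \<Sum>j=1..n. f i * x i j)
      = (\<Sum>i=1..n. f i * ((\<Sum>j=1..n. x j i) - (\<Sum>j=1..n. x i j)))"
    by (simp add: right_diff_distrib sum_subtractf sum_distrib_left)
  also have "\<dots> = (\<Sum>i=1..n. f i * - balance i)"
  proof (intro sum.cong refl)
    fix i assume i: "i \<in> {1..n}"
    with assms have "(\<Sum>j\<in>out_nodes i. x i j) - (\<Sum>j\<in>in_nodes i. x j i) = balance i"
      unfolding feasible_def by blast
    then have "(\<Sum>j=1..n. x j i) - (\<Sum>j=1..n. x i j) = - balance i"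
      unfolding sum_out_nodes[OF assms i] sum_in_nodes[OF assms i] by linarith
    then show "f i * ((\<Sum>j=1..n. x j i) - (\<Sum>j=1..n. x i j)) = f i * - balance i"
      by (rule arg_cong)
  qed
  \<comment> \<open>\<open>2 \<le> n\<close> keeps origin and destination apart, so the nested cases
    of \<open>balance\<close> split into two independent indicators.\<close>
  also have "\<dots> = (\<Sum>i=1..n. (if i = n then f i else 0) - (if i = 1 then f i else 0))"
    using two_nodes by (intro sum.cong) (auto simp: balance_def)
  also have "\<dots> = f n - f 1"
    using two_nodes by (simp add: sum_subtractf)
  finally show ?thesis .
qed

lemma energy_along_selected_arc:
  assumes feas: "feasible x r E" and path: "selects_simple_path x"
    and i: "i \<in> {1..n}" and j: "j \<in> {1..n}" and sel: "x i j = 1"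
  shows "E j = E i + r i - e i j"
proof -
  have arc: "(i, j) \<in> A"
    using feasible_arcD(1)[OF feas i j] sel by simp
  have uniq: "x k j = 0" if k: "k \<in> {1..n}" "k \<noteq> i" for k
  proof (rule ccontr)
    assume "x k j \<noteq> 0"
    \<comment> \<open>Binarity turns a nonzero value into a selected arc, so \<open>(k, j)\<close>
      and \<open>(i, j)\<close> would both be consecutive pairs of the path.\<close>
    then have "x k j = 1"
      using feasible_arcD(2)[OF feas k(1) j] by simp
    moreover obtain p where "distinct p"
      "{(i, j). i \<in> {1..n} \<and> j \<in> {1..n} \<and> x i j = 1} = set (zip p (tl p))"
      using path unfolding selects_simple_path_def by blast
    ultimately have "k = i"
      using distinct_zip_tl_pred_unique[of p k j i] i j k sel by blast
    with k show False by simp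
  qed
  \<comment> \<open>The energy equation is imposed only from node 2 on, so the origin has to be
    excluded as head of the arc.\<close>
  have "j \<noteq> 1"
    using no_arc_into_origin arc i by auto
  then have "j \<in> {2..n}"
    using j by auto
  then have "E j = (\<Sum>k\<in>in_nodes j. (E k + r k - e k j) * x k j)"
    using feas unfolding feasible_def by blast
  also have "\<dots> = (\<Sum>k\<in>{i}. (E k + r k - e k j) * x k j)"
    using arc i uniq by (intro sum.mono_neutral_right) (auto simp: in_nodes_def)
  finally show ?thesis
    using sel by simp
qed

end

theorem lemma1:
  fixes n :: nat
    and A :: "(nat \<times> nat) set"
    and \<tau> e :: "nat \<Rightarrow> nat \<Rightarrow> real"
    and g :: "nat \<Rightarrow> real"
    and B E_init :: real
    and x :: "nat \<Rightarrow> nat \<Rightarrow> real"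
    and r E :: "nat \<Rightarrow> real"
  assumes "ev_network n A \<tau> e g B E_init"
    and "ev_network.optimal n A \<tau> e g B E_init x r E"
    and "ev_network.selects_simple_path n x"
  shows "(\<Sum>i=1..n. \<Sum>j=1..n. (r i * x i j - e i j * x i j) * g i)
           = (\<Sum>i=1..n. \<Sum>j=1..n. (E j - E i) * g i * x i j)
       \<and> (\<Sum>i=1..n. \<Sum>j=1..n. (E j - E i) * g i * x i j)
           = (\<Sum>i=1..n. \<Sum>j=1..n. E j * (g i - g j) * x i j) - E 1 * g 1"
proof -
  interpret ev_network n A \<tau> e g B E_init by fact
  have feas: "feasible x r E"
    using assms(2) unfolding optimal_def by blast
  have "(r i * x i j - e i j * x i j) * g i = (E j - E i) * g i * x i j"
    if "i \<in> {1..n}" "j \<in> {1..n}" for i j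
    using feasible_arcD(2)[OF feas that] energy_along_selected_arc[OF feas assms(3) that]
    \<comment> \<open>Off the selected arcs both sides vanish; on them the energy increment is
      \<open>r i - e i j\<close>.\<close>
    by (cases "x i j = 0") simp_all
  then have "(\<Sum>i=1..n. \<Sum>j=1..n. (r i * x i j - e i j * x i j) * g i)
      = (\<Sum>i=1..n. \<Sum>j=1..n. (E j - E i) * g i * x i j)"
    by (intro sum.cong refl) blast
  \<comment> \<open>Adding and subtracting \<open>E j * g j\<close> in each term isolates the
    increment of the potential.\<close>
  moreover have "(\<Sum>i=1..n. \<Sum>j=1..n. (E j - E i) * g i * x i j)
      = (\<Sum>i=1..n. \<Sum>j=1..n. E j * (g i - g j) * x i j)
        + (\<Sum>i=1..n. \<Sum>j=1..n. (E j * g j - E i * g i) * x i j)"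
    by (simp add: algebra_simps flip: sum.distrib)
  moreover have "(\<Sum>i=1..n. \<Sum>j=1..n. (E j * g j - E i * g i) * x i j) = - (E 1 * g 1)"
    using sum_potential_difference[OF feas, of "\<lambda>i. E i * g i"] charging_destination by simp
  ultimately show ?thesis by simp
qed

end
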